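(* Let $\Gamma=(V,E)$ be any directed graph with a countable number of vertices and finite degree at each vertex. Let $R_v$, $v\in V$, be a collection of integers. Assume that there exist real numbers $p_e$, $e\in E$, such that $p_e=-p_{-e}$ for every $e\in E$ and $\sum_{e\in E_v}p_e=R_v$ for every $v\in V$. Then there exist integers $t_e\in\{[p_e],[p_e]+1\}$, $e\in E$, such that $$\sum_{e\in E_v}t_e=R_v\quad\text{for every }v\in V,\qquad t_e=-t_{-e}\quad\text{for every }e\in E.$$
   Context: For a directed graph $\Gamma=(V,E)$, $E_v$ denotes the set of edges starting at the vertex $v$. For a directed edge $e$, $-e$ denotes the same edge taken in the opposite direction; the edge set $E$ is closed under $e\mapsto -e$. For a real number $y$, $[y]$ denotes the integer part (floor) of $y$. *)

theory Defs
  imports Complex_Main "HOL-Library.Countable_Set" "Graph_Theory.Bidirected_Digraph"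
begin

text \<open>
  A (possibly infinite) digraph together with an operation \<open>opp\<close> on its arcs that sends
  an arc \<open>e\<close> to the oppositely oriented arc \<open>-e\<close>. Parallel arcs and loops are allowed.
  In contrast to \<^locale>\<open>bidirected_digraph\<close>, a loop may be its own opposite, as is the case
  for a loop \<open>(v, v)\<close> when arcs are pairs of vertices.
\<close>

locale opp_digraph = wf_digraph G for G :: "('a, 'b) pre_digraph" +
  fixes opp :: "'b \<Rightarrow> 'b"
  assumes opp_in_arcs: "e \<in> arcs G \<Longrightarrow> opp e \<in> arcs G"
    and opp_opp: "e \<in> arcs G \<Longrightarrow> opp (opp e) = e"
    and tail_opp: "e \<in> arcs G \<Longrightarrow> tail G (opp e) = head G e"
    and head_opp: "e \<in> arcs G \<Longrightarrow> head G (opp e) = tail G e"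

lemma (in bidirected_digraph) opp_digraph_arev: "opp_digraph G arev"
  by unfold_locales simp_all

lemma opp_digraph_pairs:
  assumes "E \<subseteq> V \<times> V" and "sym E"
  shows "opp_digraph \<lparr>verts = V, arcs = E, tail = fst, head = snd\<rparr> prod.swap"
  using assms by unfold_locales (auto dest: symD)

end

theory Submission
  imports Defs "HOL-Analysis.Function_Topology"
begin

text \<open>
  On a finite graph the rounding is obtained by making fewer and fewer values fractional. An arc
  with a fractional value cannot be the only such arc at its tail, because the sum there is an
  integer. Hence one can walk along fractional arcs for ever without turning back, and such a walk
  in a finite graph closes up to a cycle (\<open>nonbacktracking_circulation\<close>). Pushing flow around the
  cycle keeps all sums at vertices, and if it is pushed until the first value on the cycle hits an
  integer, then no value leaves the interval between its floor and its ceiling, while at least one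
  fractional value has disappeared. Iterating, all values become integers (\<open>finite_rounding\<close>).

  The infinite case follows by compactness. The candidates form a product of two-element sets, which
  is compact by Tychonoff's theorem, and each required equation involves finitely many arcs and so
  defines a closed set. It therefore suffices to satisfy finitely many equations at a time.
  These concern a finite set \<open>S\<close> of vertices and finitely many arcs; after all vertices outside
  \<open>S\<close> are contracted to a single one, they live on a finite graph. The sum at the contracted
  vertex is again an integer, since by antisymmetry the sums at all vertices of a finite graph add
  up to zero. So the finite case applies (\<open>finite_subsystem_rounding\<close>).
\<close>

section \<open>Circulations and rounding on finite graphs\<close>

text \<open>
  The graph is given by its arcs alone: \<open>tl\<close> is the tail of an arc and \<open>tl (opp e)\<close> the head of
  \<open>e\<close>. With only a labelling of the tails, a set of vertices can later be contracted by relabelling.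

  The circulation is the indicator of a cycle minus that of its reversal. The cycle is a shortest
  closed stretch of an infinite walk that never turns back; minimality prevents it from
  containing both an arc and its opposite, so the two indicators do not cancel.
\<close>

lemma nonbacktracking_circulation:
  fixes F :: "'b set" and opp :: "'b \<Rightarrow> 'b" and tl :: "'b \<Rightarrow> 'c"
  assumes fin: "finite F" and "F \<noteq> {}"
    and opp: "\<And>e. e \<in> F \<Longrightarrow> opp e \<in> F" "\<And>e. e \<in> F \<Longrightarrow> opp (opp e) = e"
      "\<And>e. e \<in> F \<Longrightarrow> opp e \<noteq> e"
    and continue: "\<And>e. e \<in> F \<Longrightarrow> \<exists>f\<in>F. tl f = tl (opp e) \<and> f \<noteq> opp e"
  obtains x :: "'b \<Rightarrow> real" where
    "\<And>e. e \<notin> F \<Longrightarrow> x e = 0"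
    "\<And>e. e \<in> F \<Longrightarrow> x (opp e) = - x e"
    "\<And>v. (\<Sum>e | e \<in> F \<and> tl e = v. x e) = 0"
    "\<exists>e\<in>F. x e \<noteq> 0"
proof -
  obtain w :: "nat \<Rightarrow> 'b" where w:
    "\<And>n. w n \<in> F" "\<And>n. tl (w (Suc n)) = tl (opp (w n))" "\<And>n. w (Suc n) \<noteq> opp (w n)"
  proof -
    have "\<exists>w. \<forall>n. w n \<in> F \<and> (tl (w (Suc n)) = tl (opp (w n)) \<and> w (Suc n) \<noteq> opp (w n))"
      by (rule dependent_nat_choice) (use \<open>F \<noteq> {}\<close> continue in auto)
    then show ?thesis using that by blast
  qed
  define h where "h n = tl (opp (w n))" for n
  have "\<exists>d i. 0 < d \<and> h i = h (i + d)"
  proof -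
    have "finite (range h)"
      by (rule finite_subset[of _ "tl ` F"]) (use fin w(1) opp(1) in \<open>auto simp: h_def\<close>)
    then have "\<not> inj h"
      using finite_imageD infinite_UNIV_nat by blast
    then obtain a b where "h a = h b" "a < b"
      unfolding inj_def by (metis nat_neq_iff)
    then show ?thesis
      by (intro exI[of _ "b - a"] exI[of _ a]) auto
  qed
  then obtain d i where d: "0 < d" "h i = h (i + d)"
    and dmin: "\<And>d' i'. 0 < d' \<Longrightarrow> h i' = h (i' + d') \<Longrightarrow> d \<le> d'"
    using exists_least_iff[of "\<lambda>d. \<exists>i. 0 < d \<and> h i = h (i + d)"] by (metis not_less)
  \<comment> \<open>If an arc is followed later by its opposite, the part strictly in between is a shorter closed
    stretch; it is not empty, as the walk does not turn back.\<close>
  have no_return: False if "i < a" "a \<le> i + d" "i < b" "b \<le> i + d" "w a = opp (w b)" for a b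
  proof -
    have *: False if ab: "i < a" "b \<le> i + d" "a < b" "w a = opp (w b)" for a b
    proof -
      obtain c where c: "b = Suc c" using ab by (cases b) auto
      have "opp (w a) = w b" using ab w(1) opp(2) by simp
      then have "h a = h c" using w(2)[of c] c by (simp add: h_def)
      moreover have "a \<noteq> c" using w(3)[of a] \<open>opp (w a) = w b\<close> c by auto
      ultimately have "d \<le> c - a" using dmin[of "c - a" a] ab c by simp
      then show False using ab c by linarith
    qed
    show False
    proof (cases a b rule: linorder_cases)
      case less then show ?thesis using *[of a b] that by blast
    next
      case greater
      have "w b = opp (w a)" using that w(1) opp(2) by simp
      then show ?thesis using *[of b a] that greater by blast
    next
      case equal then show ?thesis using that w(1) opp(3) by metis
    qed
  qed
  define x :: "'b \<Rightarrow> real" where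
    "x e = (\<Sum>k = i..<i + d. of_bool (w (Suc k) = e) - of_bool (opp (w (Suc k)) = e))" for e
  show ?thesis
  proof
    show "x e = 0" if "e \<notin> F" for e
      unfolding x_def using that w(1) opp(1) by (intro sum.neutral) (metis diff_self of_bool_eq_iff)
    show "x (opp e) = - x e" if "e \<in> F" for e
    proof -
      have "(w k = opp e) = (opp (w k) = e)" "(opp (w k) = opp e) = (w k = e)" for k
        using opp(2) w(1) that by metis+
      then show ?thesis unfolding x_def by (simp flip: sum_negf)
    qed
    \<comment> \<open>Each passage of the walk through \<open>v\<close> contributes one arc entering and one leaving.\<close>
    show "(\<Sum>e | e \<in> F \<and> tl e = v. x e) = 0" for v
    proof -
      have one: "(\<Sum>e | e \<in> F \<and> tl e = v. of_bool (f = e)) = (of_bool (tl f = v) :: real)" if "f \<in> F" for f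
        using fin that by (simp add: of_bool_def sum.delta)
      have "(\<Sum>e | e \<in> F \<and> tl e = v. x e)
          = (\<Sum>k = i..<i + d. of_bool (tl (w (Suc k)) = v) - of_bool (tl (opp (w (Suc k))) = v))"
        unfolding x_def by (subst sum.swap) (simp add: sum_subtractf one w(1) opp(1))
      also have "\<dots> = (\<Sum>k = i..<i + d. of_bool (h k = v) - of_bool (h (Suc k) = v))"
        by (simp add: h_def w(2))
      also have "\<dots> = of_bool (h i = v) - of_bool (h (i + d) = v)"
        using sum_Suc_diff'[of i "i + d" "\<lambda>k. - of_bool (h k = v) :: real"] by simp
      finally show ?thesis using d by simp
    qed
    have "x (w (i + d)) > 0"
    proof -
      have "opp (w (Suc k)) \<noteq> w (i + d)" if "k \<in> {i..<i + d}" for k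
        using no_return[of "i + d" "Suc k"] that d by auto
      then have "x (w (i + d)) = (\<Sum>k = i..<i + d. of_bool (w (Suc k) = w (i + d)))"
        unfolding x_def by simp
      also have "\<dots> > 0"
        by (rule sum_pos2[of _ "i + d - 1"]) (use d in auto)
      finally show ?thesis .
    qed
    then show "\<exists>e\<in>F. x e \<noteq> 0" using w(1)[of "i + d"] by (metis less_irrefl)
  qed
qed

text \<open>
  The induction is on the number of fractional values. The bounds use the ceiling instead of
  the floor plus one: this pins down integral values, so that the bounds are
  antisymmetric and can only tighten when the values change from \<open>q\<close> to a \<open>q'\<close> that lies within them.
\<close>

lemma finite_rounding:
  fixes A :: "'b set" and opp :: "'b \<Rightarrow> 'b" and tl :: "'b \<Rightarrow> 'c" and q :: "'b \<Rightarrow> real"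
  assumes fin: "finite A"
    and opp: "\<And>e. e \<in> A \<Longrightarrow> opp e \<in> A" "\<And>e. e \<in> A \<Longrightarrow> opp (opp e) = e"
    and anti: "\<And>e. e \<in> A \<Longrightarrow> q (opp e) = - q e"
    and int: "\<And>v. (\<Sum>e | e \<in> A \<and> tl e = v. q e) \<in> \<int>"
  shows "\<exists>t :: 'b \<Rightarrow> int. (\<forall>e\<in>A. \<lfloor>q e\<rfloor> \<le> t e \<and> t e \<le> \<lceil>q e\<rceil> \<and> t (opp e) = - t e) \<and>
           (\<forall>v. (\<Sum>e | e \<in> A \<and> tl e = v. real_of_int (t e)) = (\<Sum>e | e \<in> A \<and> tl e = v. q e))"
  using anti int
proof (induction "card {e \<in> A. q e \<notin> \<int>}" arbitrary: q rule: less_induct)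
  case less
  note anti = less.prems(1) and int = less.prems(2)
  define F where "F = {e \<in> A. q e \<notin> \<int>}"
  have finF: "finite F" using fin by (simp add: F_def)
  show ?case
  proof (cases "F = {}")
    case True
    then have "\<And>e. e \<in> A \<Longrightarrow> real_of_int \<lfloor>q e\<rfloor> = q e"
      by (auto simp: F_def elim: Ints_cases)
    moreover from this have "\<lfloor>q (opp e)\<rfloor> = - \<lfloor>q e\<rfloor>" if "e \<in> A" for e
      using that anti opp(1) by (metis of_int_eq_iff of_int_minus)
    ultimately show ?thesis
      by (intro exI[of _ "\<lambda>e. \<lfloor>q e\<rfloor>"]) (auto intro!: sum.cong simp: floor_le_ceiling)
  next
    case False
    have oppF: "opp e \<in> F" if "e \<in> F" for e
      using that opp(1) anti by (auto simp: F_def)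
    have continue: "\<exists>f\<in>F. tl f = tl (opp e) \<and> f \<noteq> opp e" if "e \<in> F" for e
    proof (rule ccontr)
      assume "\<not> ?thesis"
      then have others: "q f \<in> \<int>" if "f \<in> A" "tl f = tl (opp e)" "f \<noteq> opp e" for f
        using that by (auto simp: F_def)
      let ?B = "{f. f \<in> A \<and> tl f = tl (opp e)}"
      have "(\<Sum>f\<in>?B. q f) = q (opp e) + (\<Sum>f\<in>?B - {opp e}. q f)"
        using fin oppF[OF that] by (intro sum.remove) (auto simp: F_def)
      moreover have "(\<Sum>f\<in>?B - {opp e}. q f) \<in> \<int>"
        by (rule Ints_sum) (use others in auto)
      ultimately have "q (opp e) \<in> \<int>"
        using int[of "tl (opp e)"] by (metis Ints_diff add_diff_cancel_right')
      then show False using oppF[OF that] by (simp add: F_def)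
    qed
    have oppF2: "opp (opp e) = e" if "e \<in> F" for e using that opp(2) by (simp add: F_def)
    have oppF3: "opp e \<noteq> e" if "e \<in> F" for e
      using that anti[of e] by (auto simp: F_def)
    obtain x where x: "\<And>e. e \<notin> F \<Longrightarrow> x e = (0::real)" "\<And>e. e \<in> F \<Longrightarrow> x (opp e) = - x e"
      "\<And>v. (\<Sum>e | e \<in> F \<and> tl e = v. x e) = 0" "\<exists>e\<in>F. x e \<noteq> 0"
      by (rule nonbacktracking_circulation[OF finF False oppF oppF2 oppF3 continue]) blast+
    \<comment> \<open>\<open>r e\<close> (for \<open>x e \<noteq> 0\<close>) is the multiple of \<open>x\<close> at which the value of \<open>e\<close> first becomes an integer.\<close>
    define r where "r e = (if x e > 0 then (\<lceil>q e\<rceil> - q e) / x e else (q e - \<lfloor>q e\<rfloor>) / - x e)" for e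
    define X where "X = {e \<in> F. x e \<noteq> 0}"
    define s where "s = Min (r ` X)"
    have X: "finite X" "X \<noteq> {}" using finF x(4) by (auto simp: X_def)
    then obtain m where m: "m \<in> X" "s = r m"
      unfolding s_def by (metis (mono_tags) Min_in finite_imageI image_iff image_is_empty)
    have s_le: "s \<le> r e" if "e \<in> X" for e
      using X that by (simp add: s_def)
    have s_ge: "0 \<le> s"
      unfolding m(2) r_def by (auto intro!: divide_nonneg_nonneg divide_nonneg_nonpos)
    define q' where "q' e = q e + s * x e" for e
    have range: "\<lfloor>q e\<rfloor> \<le> q' e" "q' e \<le> \<lceil>q e\<rceil>" for e
    proof -
      consider "x e = 0" | "e \<in> X" "x e > 0" | "e \<in> X" "x e < 0"
        using x(1)[of e] by (cases "x e" "0::real" rule: linorder_cases) (auto simp: X_def)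
      then have "\<lfloor>q e\<rfloor> \<le> q' e \<and> q' e \<le> \<lceil>q e\<rceil>"
      proof cases
        case 1 then show ?thesis by (simp add: q'_def)
      next
        case 2
        then have "s * x e \<le> \<lceil>q e\<rceil> - q e" using s_le[of e] by (simp add: r_def field_simps)
        moreover have "0 \<le> s * x e" using 2 s_ge by simp
        ultimately show ?thesis unfolding q'_def by linarith
      next
        case 3
        then have "s * - x e \<le> q e - \<lfloor>q e\<rfloor>" using s_le[of e] by (simp add: r_def field_simps)
        moreover have "s * x e \<le> 0" using 3 s_ge by (simp add: mult_nonneg_nonpos)
        ultimately show ?thesis unfolding q'_def by linarith
      qed
      then show "\<lfloor>q e\<rfloor> \<le> q' e" "q' e \<le> \<lceil>q e\<rceil>" by auto
    qed
    have sums: "(\<Sum>e | e \<in> A \<and> tl e = v. q' e) = (\<Sum>e | e \<in> A \<and> tl e = v. q e)" for v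
    proof -
      have "(\<Sum>e | e \<in> A \<and> tl e = v. x e) = (\<Sum>e | e \<in> F \<and> tl e = v. x e)"
        using fin x(1) by (intro sum.mono_neutral_right) (auto simp: F_def)
      then show ?thesis
        using x(3) by (simp add: q'_def sum.distrib flip: sum_distrib_left)
    qed
    have anti': "q' (opp e) = - q' e" if "e \<in> A" for e
    proof -
      have "x (opp e) = - x e"
        using x(1,2) oppF opp(2) that by (metis neg_equal_0_iff_equal)
      then show ?thesis using anti[OF that] by (simp add: q'_def)
    qed
    have "q' m \<in> \<int>"
      using m by (auto simp: q'_def r_def X_def)
    moreover have "q' e \<in> \<int>" if "e \<in> A" "q e \<in> \<int>" for e
      using that x(1)[of e] by (simp add: q'_def F_def)
    ultimately have "{e \<in> A. q' e \<notin> \<int>} \<subset> F"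
      using m by (auto simp: F_def X_def)
    then have "card {e \<in> A. q' e \<notin> \<int>} < card {e \<in> A. q e \<notin> \<int>}"
      using psubset_card_mono[OF finF] by (simp add: F_def)
    from less.hyps[OF this anti'] obtain t where t:
      "\<forall>e\<in>A. \<lfloor>q' e\<rfloor> \<le> t e \<and> t e \<le> \<lceil>q' e\<rceil> \<and> t (opp e) = - t e"
      "\<forall>v. (\<Sum>e | e \<in> A \<and> tl e = v. real_of_int (t e)) = (\<Sum>e | e \<in> A \<and> tl e = v. q' e)"
      using int sums by force
    have "\<lfloor>q e\<rfloor> \<le> \<lfloor>q' e\<rfloor>" "\<lceil>q' e\<rceil> \<le> \<lceil>q e\<rceil>" for e
      using range[of e] by (simp_all add: le_floor_iff ceiling_le_iff)
    then show ?thesis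
      using t sums by (intro exI[of _ t]) (metis order_trans)
  qed
qed

section \<open>The infinite case by compactness\<close>

text \<open>
  Only arcs at \<open>S\<close>, arcs in \<open>T\<close> and their opposites matter; every other value may be rounded down.
  Tails outside \<open>S\<close> all receive the label \<open>None\<close>, which is the contraction of the outside.
\<close>

lemma finite_subsystem_rounding:
  fixes G :: "('a, 'b) pre_digraph" and p :: "'b \<Rightarrow> real"
  assumes G: "opp_digraph G opp"
    and anti: "\<And>e. e \<in> arcs G \<Longrightarrow> p e = - p (opp e)"
    and S: "finite S" "S \<subseteq> verts G" "\<And>v. v \<in> S \<Longrightarrow> finite (out_arcs G v)"
      "\<And>v. v \<in> S \<Longrightarrow> (\<Sum>e\<in>out_arcs G v. p e) \<in> \<int>"
    and T: "finite T" "T \<subseteq> arcs G"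
  shows "\<exists>t :: 'b \<Rightarrow> int. (\<forall>e. t e \<in> {\<lfloor>p e\<rfloor>, \<lfloor>p e\<rfloor> + 1}) \<and>
           (\<forall>v\<in>S. real_of_int (\<Sum>e\<in>out_arcs G v. t e) = (\<Sum>e\<in>out_arcs G v. p e)) \<and>
           (\<forall>e\<in>T. t e = - t (opp e))"
proof -
  interpret opp_digraph G opp by (fact G)
  define B where "B = (\<Union>v\<in>S. out_arcs G v) \<union> T"
  define A where "A = B \<union> opp ` B"
  define lab where "lab e = (if tail G e \<in> S then Some (tail G e) else None)" for e
  have B_arcs: "B \<subseteq> arcs G" using T(2) by (auto simp: B_def)
  then have A_arcs: "A \<subseteq> arcs G" using opp_in_arcs by (auto simp: A_def)
  have fin: "finite A" using S(1,3) T(1) by (simp add: A_def B_def)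
  have oppA: "opp e \<in> A" if "e \<in> A" for e
    using that B_arcs opp_opp by (auto simp: A_def)
  have opp2: "opp (opp e) = e" if "e \<in> A" for e
    using that A_arcs opp_opp by blast
  have antiA: "p (opp e) = - p e" if "e \<in> A" for e
    using anti[of e] A_arcs that by auto
  have some: "{e. e \<in> A \<and> lab e = Some v} = out_arcs G v" if "v \<in> S" for v
    using that A_arcs by (auto simp: lab_def A_def B_def split: if_splits dest: opp_in_arcs)
  have some_int: "(\<Sum>e | e \<in> A \<and> lab e = Some v. p e) \<in> \<int>" for v
  proof (cases "v \<in> S")
    case True then show ?thesis using S(4) by (simp add: some)
  next
    case False
    then have "{e. e \<in> A \<and> lab e = Some v} = {}" by (auto simp: lab_def split: if_splits)
    then show ?thesis by (simp only: sum.empty Ints_0)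
  qed
  have total: "(\<Sum>e\<in>A. p e) = 0"
  proof -
    have "(\<Sum>e\<in>A. p e) = (\<Sum>e\<in>A. p (opp e))"
      by (rule sum.reindex_bij_witness[of _ opp opp]) (auto simp: oppA opp2)
    also have "\<dots> = - (\<Sum>e\<in>A. p e)" by (simp add: antiA sum_negf)
    finally show ?thesis by simp
  qed
  have int: "(\<Sum>e | e \<in> A \<and> lab e = l. p e) \<in> \<int>" for l
  proof (cases l)
    case None
    \<comment> \<open>The sum at the contracted vertex is minus the total of the integral sums at \<open>S\<close>.\<close>
    have "(\<Sum>e\<in>A. p e) = (\<Sum>l\<in>insert None (Some ` S). \<Sum>e | e \<in> A \<and> lab e = l. p e)"
      by (rule sum.group[symmetric]) (use fin S(1) in \<open>auto simp: lab_def\<close>)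
    then have "(\<Sum>e | e \<in> A \<and> lab e = None. p e)
        = - (\<Sum>l\<in>Some ` S. \<Sum>e | e \<in> A \<and> lab e = l. p e)"
      using S(1) total by (simp add: sum.insert)
    moreover have "(\<Sum>l\<in>Some ` S. \<Sum>e | e \<in> A \<and> lab e = l. p e) \<in> \<int>"
      by (rule Ints_sum) (use some_int in auto)
    ultimately show ?thesis using None by simp
  next
    case (Some v) then show ?thesis using some_int by simp
  qed
  obtain t :: "'b \<Rightarrow> int" where t:
    "\<And>e. e \<in> A \<Longrightarrow> \<lfloor>p e\<rfloor> \<le> t e \<and> t e \<le> \<lceil>p e\<rceil> \<and> t (opp e) = - t e"
    "\<And>l. (\<Sum>e | e \<in> A \<and> lab e = l. real_of_int (t e)) = (\<Sum>e | e \<in> A \<and> lab e = l. p e)"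
    using finite_rounding[of A opp p lab, OF fin oppA opp2 antiA int] by blast
  define t' where "t' e = (if e \<in> A then t e else \<lfloor>p e\<rfloor>)" for e
  have "t' e \<in> {\<lfloor>p e\<rfloor>, \<lfloor>p e\<rfloor> + 1}" for e
    using t(1)[of e] by (auto simp: t'_def) linarith
  moreover have "real_of_int (\<Sum>e\<in>out_arcs G v. t' e) = (\<Sum>e\<in>out_arcs G v. p e)" if "v \<in> S" for v
  proof -
    have "t' e = t e" if "e \<in> out_arcs G v" for e
      using that \<open>v \<in> S\<close> by (auto simp: t'_def A_def B_def)
    then show ?thesis using t(2)[of "Some v"] some[OF that] by simp
  qed
  moreover have "t' e = - t' (opp e)" if "e \<in> T" for e
  proof -
    have "e \<in> A" using that by (simp add: A_def B_def)
    then show ?thesis using t(1)[of e] oppA[of e] by (simp add: t'_def)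
  qed
  ultimately show ?thesis by blast
qed

theorem theorem3:
  fixes G :: "('a, 'b) pre_digraph"
    and opp :: "'b \<Rightarrow> 'b"
    and R :: "'a \<Rightarrow> int"
    and p :: "'b \<Rightarrow> real"
  assumes "opp_digraph G opp"
    and "countable (verts G)"
    and "\<And>v. v \<in> verts G \<Longrightarrow> finite (out_arcs G v)"
    and "\<And>e. e \<in> arcs G \<Longrightarrow> p e = - p (opp e)"
    and "\<And>v. v \<in> verts G \<Longrightarrow> (\<Sum>e\<in>out_arcs G v. p e) = real_of_int (R v)"
  shows "\<exists>t :: 'b \<Rightarrow> int.
           (\<forall>e\<in>arcs G. t e \<in> {\<lfloor>p e\<rfloor>, \<lfloor>p e\<rfloor> + 1}) \<and>
           (\<forall>v\<in>verts G. (\<Sum>e\<in>out_arcs G v. t e) = R v) \<and>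
           (\<forall>e\<in>arcs G. t e = - t (opp e))"
proof -
  define K :: "('b \<Rightarrow> real) set" where
    "K = (\<Pi>\<^sub>E e\<in>UNIV. {real_of_int \<lfloor>p e\<rfloor>, real_of_int \<lfloor>p e\<rfloor> + 1})"
  have "compact K"
    using compactin_PiE[of "\<lambda>_::'b. euclidean :: real topology" UNIV
        "\<lambda>e. {real_of_int \<lfloor>p e\<rfloor>, real_of_int \<lfloor>p e\<rfloor> + 1}"]
    by (simp add: K_def euclidean_product_topology)
  \<comment> \<open>Equations are indexed by vertices (sums) and arcs (antisymmetry). Candidates take real values,
    for which the continuity of finite sums is at hand.\<close>
  define sat :: "'a + 'b \<Rightarrow> ('b \<Rightarrow> real) set" where
    "sat = case_sum (\<lambda>v. {t. (\<Sum>e\<in>out_arcs G v. t e) = real_of_int (R v)})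
                    (\<lambda>e. {t. t e = - t (opp e)})"
  have "closed (sat c)" for c
    by (cases c) (auto simp: sat_def intro!: closed_Collect_eq continuous_on_sum
        continuous_on_minus continuous_on_product_coordinates continuous_on_const)
  moreover have "K \<inter> (\<Inter>c\<in>C. sat c) \<noteq> {}" if C: "finite C" "C \<subseteq> verts G <+> arcs G" for C
  proof -
    have "\<exists>t :: 'b \<Rightarrow> int. (\<forall>e. t e \<in> {\<lfloor>p e\<rfloor>, \<lfloor>p e\<rfloor> + 1}) \<and>
           (\<forall>v\<in>Inl -` C. real_of_int (\<Sum>e\<in>out_arcs G v. t e) = (\<Sum>e\<in>out_arcs G v. p e)) \<and>
           (\<forall>e\<in>Inr -` C. t e = - t (opp e))"
      using C assms(3,5)
      by (intro finite_subsystem_rounding assms(1,4) finite_vimageI) auto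
    then obtain t :: "'b \<Rightarrow> int" where t: "\<And>e. t e \<in> {\<lfloor>p e\<rfloor>, \<lfloor>p e\<rfloor> + 1}"
      "\<And>v. Inl v \<in> C \<Longrightarrow> real_of_int (\<Sum>e\<in>out_arcs G v. t e) = (\<Sum>e\<in>out_arcs G v. p e)"
      "\<And>e. Inr e \<in> C \<Longrightarrow> t e = - t (opp e)"
      unfolding vimage_eq[symmetric] by blast
    have "(\<lambda>e. real_of_int (t e)) \<in> K"
      using t(1) by (force simp: K_def)
    moreover have "(\<lambda>e. real_of_int (t e)) \<in> sat c" if "c \<in> C" for c
      using that C(2) t(2) assms(5) t(3) by (cases c) (auto simp: sat_def)
    ultimately show ?thesis by blast
  qed
  ultimately obtain y where y: "y \<in> K" "\<And>c. c \<in> verts G <+> arcs G \<Longrightarrow> y \<in> sat c"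
    using compact_imp_fip_image[OF \<open>compact K\<close>, of "verts G <+> arcs G" sat] by blast
  define t where "t e = \<lfloor>y e\<rfloor>" for e
  have yK: "y e \<in> {real_of_int \<lfloor>p e\<rfloor>, real_of_int \<lfloor>p e\<rfloor> + 1}" for e
    using y(1) by (auto simp: K_def)
  have y_t: "y e = real_of_int (t e)" for e
    using yK[of e] by (auto simp: t_def)
  have "t e \<in> {\<lfloor>p e\<rfloor>, \<lfloor>p e\<rfloor> + 1}" for e
    using yK[of e] by (auto simp: t_def)
  moreover have "(\<Sum>e\<in>out_arcs G v. t e) = R v" if "v \<in> verts G" for v
    using y(2)[OF InlI[OF that]] by (simp add: sat_def y_t flip: of_int_sum)
  moreover have "t e = - t (opp e)" if "e \<in> arcs G" for e
    using y(2)[OF InrI[OF that]] by (simp add: sat_def y_t flip: of_int_minus)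
  ultimately show ?thesis by blast
qed

end
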